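(* Let $A\in\mathbb{C}^{n\times n}$ be a Hermitian matrix that can be colored with $c\ge 2$ colors. Then for any real diagonal matrix $B\in\mathbb{C}^{n\times n}$ and every $m=1,\dots,n$, $$\sum_{i=1}^m\lambda_i^\downarrow(B-A)\ \ge\ \sum_{i=1}^m\lambda_i^\downarrow\Big(B+\frac{1}{c-1}A\Big)\ \ge\ \sum_{i=1}^m\lambda_i^\downarrow(B+A)-\frac{c-2}{c-1}\sum_{i=1}^m\lambda_i^\downarrow(A).$$
   Context: Let $V=\{1,\dots,n\}$. A Hermitian matrix $A=(a_{k\ell})\in\mathbb{C}^{n\times n}$ can be colored with $c$ colors if there is a partition of $V$ into disjoint sets $V_1,\dots,V_c$ such that for each $s$, $a_{k\ell}=0$ for all $k,\ell\in V_s$. For a Hermitian matrix $X$, $\lambda_1^\downarrow(X)\ge\dots\ge\lambda_n^\downarrow(X)$ are its eigenvalues in non-increasing order. *)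

theory Defs
  imports
    "Jordan_Normal_Form.Schur_Decomposition"
    "HOL-Library.Disjoint_Sets"
    "HOL-Library.Multiset"
begin

definition hermitian_mat :: "complex mat \<Rightarrow> bool" where
  "hermitian_mat A \<longleftrightarrow> square_mat A \<and> mat_adjoint A = A"

definition real_diagonal_mat :: "complex mat \<Rightarrow> bool" where
  "real_diagonal_mat B \<longleftrightarrow>
     square_mat B \<and> diagonal_mat B \<and> (\<forall>i<dim_row B. B $$ (i, i) \<in> \<real>)"

text \<open>Matrix indices start at 0, so the vertex set is \<open>{0..<n}\<close>. As usual for
  colourings, colour classes may be empty.\<close>

definition colorable_mat :: "complex mat \<Rightarrow> nat \<Rightarrow> bool" where
  "colorable_mat A c \<longleftrightarrow>
     (\<exists>V :: nat \<Rightarrow> nat set.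
        (\<Union>s\<in>{1..c}. V s) = {0..<dim_row A} \<and>
        disjoint_family_on V {1..c} \<and>
        (\<forall>s\<in>{1..c}. \<forall>k\<in>V s. \<forall>l\<in>V s. A $$ (k, l) = 0))"

text \<open>Eigenvalues are repeated according to their multiplicity as roots of the
  characteristic polynomial. Taking real parts loses nothing for Hermitian matrices,
  see \<open>mset_eigvals_down\<close> below.\<close>

definition eigvals_down :: "complex mat \<Rightarrow> real list" where
  "eigvals_down X = rev (sorted_list_of_multiset (image_mset Re (proots (char_poly X))))"

text \<open>The index \<open>i\<close> of \<open>lambda_down X i\<close> ranges over \<open>{1..n}\<close>.\<close>

definition lambda_down :: "complex mat \<Rightarrow> nat \<Rightarrow> real" where
  "lambda_down X i = eigvals_down X ! (i - 1)"

lemma mat_adjoint_index: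
  assumes "i < dim_col A" "j < dim_row A"
  shows "mat_adjoint A $$ (i, j) = conjugate (A $$ (j, i))"
  using assms unfolding mat_adjoint_def by (simp add: mat_of_rows_index)

lemma length_eigvals_down:
  assumes "X \<in> carrier_mat n n"
  shows "length (eigvals_down X) = n"
proof -
  have "size (proots (char_poly X)) = n"
  proof -
    obtain as where as: "char_poly X = (\<Prod>a\<leftarrow>as. [:- a, 1:])" "length as = n"
      using char_poly_factorized[OF assms] by blast
    have "proots (\<Prod>a\<leftarrow>as. [:- a, 1:]) = mset as"
    proof (induction as)
      case (Cons a as)
      have "(\<Prod>a\<leftarrow>as. [:- a, 1:]) \<noteq> 0" by (simp add: prod_list_zero_iff image_iff)
      then show ?case using Cons proots_mult[of "[:- a, 1:]"] by simp
    qed simp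
    then show ?thesis using as by simp
  qed
  then show ?thesis
    unfolding eigvals_down_def by (metis length_rev mset_sorted_list_of_multiset size_image_mset size_mset)
qed

lemma sorted_eigvals_down: "sorted_wrt (\<ge>) (eigvals_down X)"
  unfolding eigvals_down_def by (simp add: sorted_wrt_rev)

lemma hermitian_eigenvalue_real:
  assumes "hermitian_mat A" "eigenvalue A k"
  shows "k \<in> \<real>"
proof -
  define n where "n = dim_row A"
  have A: "A \<in> carrier_mat n n" and adj: "mat_adjoint A = A"
    using assms(1) unfolding hermitian_mat_def n_def by (auto simp: square_mat.simps)
  obtain v where v: "v \<in> carrier_vec n" "v \<noteq> 0\<^sub>v n" "A *\<^sub>v v = k \<cdot>\<^sub>v v"
    using assms(2) A unfolding eigenvalue_def eigenvector_def by auto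
  have herm: "A $$ (i, j) = cnj (A $$ (j, i))" if "i < n" "j < n" for i j
    using mat_adjoint_index[of i A j] that A adj by simp
  have ent: "(\<Sum>j<n. A $$ (i, j) * v $ j) = k * v $ i" if "i < n" for i
  proof -
    have "(A *\<^sub>v v) $ i = (\<Sum>j<n. A $$ (i, j) * v $ j)"
      using that A v(1) by (auto simp: scalar_prod_def atLeast0LessThan)
    then show ?thesis using v that by simp
  qed
  define S where "S = (\<Sum>i<n. \<Sum>j<n. cnj (v $ i) * A $$ (i, j) * v $ j)"
  define N where "N = (\<Sum>i<n. (cmod (v $ i))\<^sup>2)"
  have "S = (\<Sum>i<n. cnj (v $ i) * (k * v $ i))"
    unfolding S_def by (intro sum.cong refl) (simp flip: ent add: sum_distrib_left mult.assoc)
  also have "\<dots> = k * of_real N"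
    unfolding N_def of_real_sum sum_distrib_left
    by (intro sum.cong refl) (simp add: complex_norm_square mult_ac del: of_real_power)
  finally have S: "S = k * of_real N" .
  have "cnj S = (\<Sum>i<n. \<Sum>j<n. cnj (v $ j) * A $$ (j, i) * v $ i)"
    unfolding S_def cnj_sum
  proof (intro sum.cong refl, goal_cases)
    case (1 i j)
    then show ?case using herm[of j i] by (simp add: mult_ac)
  qed
  also have "\<dots> = S" unfolding S_def by (rule sum.swap)
  finally have "cnj k * of_real N = k * of_real N" unfolding S by simp
  moreover have "N \<noteq> 0"
  proof
    assume "N = 0"
    then have "\<forall>i<n. v $ i = 0" unfolding N_def by (subst (asm) sum_nonneg_eq_0_iff) auto
    then show False using v by (auto intro!: eq_vecI)
  qed
  ultimately show ?thesis by (simp add: Reals_cnj_iff)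
qed

lemma mset_eigvals_down:
  assumes "hermitian_mat A"
  shows "image_mset complex_of_real (mset (eigvals_down A)) = proots (char_poly A)"
proof -
  have A: "A \<in> carrier_mat (dim_row A) (dim_row A)"
    using assms unfolding hermitian_mat_def by (auto simp: square_mat.simps)
  have nz: "char_poly A \<noteq> 0"
    using degree_monic_char_poly[OF A] by auto
  have "complex_of_real (Re x) = x" if "x \<in># proots (char_poly A)" for x
    using that nz hermitian_eigenvalue_real[OF assms] eigenvalue_root_char_poly[OF A]
    by (simp add: of_real_Re)
  then have "image_mset (\<lambda>x. complex_of_real (Re x)) (proots (char_poly A)) = proots (char_poly A)"
    by (metis (no_types, lifting) image_mset_cong multiset.map_ident)
  then show ?thesis
    unfolding eigvals_down_def by (simp add: image_mset.compositionality o_def)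
qed

end

theory Submission
  imports Defs
begin

text \<open>Write \<open>S\<^sub>m(X)\<close> for the sum of the \<open>m\<close> largest eigenvalues of a Hermitian matrix \<open>X\<close>. By
  Ky Fan's principle, \<open>S\<^sub>m(X)\<close> is the maximum of \<open>tr (V\<^sup>* X V)\<close> over all \<open>n \<times> m\<close> isometries \<open>V\<close>;
  being a maximum of linear functionals, it is sublinear. Let \<open>D\<close> be the diagonal unitary whose
  \<open>a\<close>-th entry is the \<open>c\<close>-th root of unity indexed by the colour of \<open>a\<close>. The conjugates
  \<open>D\<^sup>k A D\<^sup>-\<^sup>k\<close> with \<open>0 \<le> k < c\<close> sum to zero because \<open>A\<close> vanishes inside the colour classes, so
  \<open>B + A / (c - 1)\<close> is the average of the matrices \<open>D\<^sup>k (B - A) D\<^sup>-\<^sup>k\<close> with \<open>1 \<le> k < c\<close>, all of which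
  have the spectrum of \<open>B - A\<close>; convexity of \<open>S\<^sub>m\<close> gives the first inequality. The second one is
  sublinearity applied to \<open>B + A = (B + A / (c - 1)) + ((c - 2) / (c - 1)) A\<close>.\<close>

section \<open>Adjoints and isometries\<close>

lemma mat_adjoint_dim [simp]:
  "dim_row (mat_adjoint A) = dim_col A" "dim_col (mat_adjoint A) = dim_row A"
  by (simp_all add: mat_adjoint_def)

lemma mat_adjoint_carrier [simp]:
  "A \<in> carrier_mat n m \<Longrightarrow> mat_adjoint A \<in> carrier_mat m n"
  by (intro carrier_matI) simp_all

lemma mat_adjoint_mult:
  fixes A B :: "complex mat"
  assumes "A \<in> carrier_mat n k" "B \<in> carrier_mat k m"
  shows "mat_adjoint (A * B) = mat_adjoint B * mat_adjoint A"
  using assms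
  by (intro eq_matI)
    (auto simp: mat_adjoint_index scalar_prod_def mult.commute intro!: sum.cong)

lemma mat_adjoint_adjoint [simp]:
  fixes A :: "complex mat"
  shows "mat_adjoint (mat_adjoint A) = A"
  by (intro eq_matI) (auto simp: mat_adjoint_index)

lemma hermitian_matI:
  assumes "A \<in> carrier_mat n n" "\<And>i j. i < n \<Longrightarrow> j < n \<Longrightarrow> A $$ (i, j) = cnj (A $$ (j, i))"
  shows "hermitian_mat A"
proof -
  have "mat_adjoint A = A"
    using assms(1) by (intro eq_matI) (auto simp: mat_adjoint_index assms(2)[symmetric])
  then show ?thesis
    using assms(1) by (auto simp: hermitian_mat_def)
qed

lemma hermitian_mat_index:
  assumes "hermitian_mat A" "A \<in> carrier_mat n n" "i < n" "j < n"
  shows "A $$ (i, j) = cnj (A $$ (j, i))"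
  using assms mat_adjoint_index[of i A j] by (auto simp: hermitian_mat_def)

text \<open>As a double sum, the entry is visibly linear in \<open>X\<close> and depends on
  \<open>V\<close> only through columns \<open>i\<close> and \<open>j\<close>. Sublinearity uses the
  first fact, \<open>ky_fan_attained\<close> the second.\<close>

lemma congruence_index:
  fixes V :: "complex mat"
  assumes V: "V \<in> carrier_mat n m" and X: "X \<in> carrier_mat n n" and ij: "i < m" "j < m"
  shows "(mat_adjoint V * X * V) $$ (i, j)
    = (\<Sum>a<n. \<Sum>b<n. cnj (V $$ (a, i)) * X $$ (a, b) * V $$ (b, j))"
proof -
  have "(mat_adjoint V * X * V) $$ (i, j)
      = (\<Sum>b<n. (\<Sum>a<n. cnj (V $$ (a, i)) * X $$ (a, b)) * V $$ (b, j))"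
    using assms by (simp add: scalar_prod_def atLeast0LessThan mat_adjoint_index)
  also have "\<dots> = (\<Sum>a<n. \<Sum>b<n. cnj (V $$ (a, i)) * X $$ (a, b) * V $$ (b, j))"
    unfolding sum_distrib_right by (rule sum.swap)
  finally show ?thesis .
qed

lemma gram_index:
  fixes V :: "complex mat"
  assumes "V \<in> carrier_mat n m" "i < m" "j < m"
  shows "(mat_adjoint V * V) $$ (i, j) = (\<Sum>a<n. cnj (V $$ (a, i)) * V $$ (a, j))"
  using assms by (simp add: scalar_prod_def atLeast0LessThan mat_adjoint_index)

lemma hermitian_mat_congruence:
  assumes "hermitian_mat A" "A \<in> carrier_mat n n" "V \<in> carrier_mat n m"
  shows "hermitian_mat (mat_adjoint V * A * V)"
proof -
  have "mat_adjoint (mat_adjoint V * A * V) = mat_adjoint V * A * V"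
    using assms(2,3) assms(1)[unfolded hermitian_mat_def]
    by (simp add: assoc_mult_mat[of _ m n _ n _ m] mat_adjoint_mult[of _ m n _ m]
        mat_adjoint_mult[of _ n n _ m])
  then show ?thesis
    using assms(2,3) by (simp add: hermitian_mat_def)
qed

lemma unitary_right:
  fixes U :: "complex mat"
  assumes "U \<in> carrier_mat n n" "mat_adjoint U * U = 1\<^sub>m n"
  shows "U * mat_adjoint U = 1\<^sub>m n"
  using mat_mult_left_right_inverse[OF _ assms(1,2)] assms(1) by simp

lemma isometry_mult:
  fixes U V :: "complex mat"
  assumes U: "U \<in> carrier_mat k n" "mat_adjoint U * U = 1\<^sub>m n"
    and V: "V \<in> carrier_mat n m" "mat_adjoint V * V = 1\<^sub>m m"
  shows "mat_adjoint (U * V) * (U * V) = 1\<^sub>m m"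
proof -
  have "mat_adjoint (U * V) * (U * V) = mat_adjoint V * mat_adjoint U * (U * V)"
    using mat_adjoint_mult[OF U(1) V(1)] by simp
  also have "\<dots> = mat_adjoint V * (mat_adjoint U * (U * V))"
    using U V by (intro assoc_mult_mat[of _ m n _ k _ m]) auto
  also have "mat_adjoint U * (U * V) = mat_adjoint U * U * V"
    using U V by (intro assoc_mult_mat[symmetric, of _ n k _ n _ m]) auto
  finally show ?thesis
    using U V by simp
qed

lemma congruence_mult:
  fixes U V X :: "complex mat"
  assumes U: "U \<in> carrier_mat k n" and V: "V \<in> carrier_mat n m" and X: "X \<in> carrier_mat k k"
  shows "mat_adjoint (U * V) * X * (U * V) = mat_adjoint V * (mat_adjoint U * X * U) * V"
proof -
  have "mat_adjoint (U * V) * X * (U * V) = mat_adjoint V * mat_adjoint U * X * (U * V)"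
    using mat_adjoint_mult[OF U V] by simp
  also have "\<dots> = mat_adjoint V * (mat_adjoint U * X) * (U * V)"
    using U V X by (subst assoc_mult_mat[of _ m n _ k _ k]) auto
  also have "\<dots> = mat_adjoint V * (mat_adjoint U * X) * U * V"
    using U V X by (intro assoc_mult_mat[symmetric, of _ m k _ n _ m]) auto
  also have "mat_adjoint V * (mat_adjoint U * X) * U = mat_adjoint V * (mat_adjoint U * X * U)"
    using U V X by (intro assoc_mult_mat[of _ m n _ k _ n]) auto
  finally show ?thesis .
qed

text \<open>Complete \<open>v\<close> to a basis, orthogonalise by Gram-Schmidt, which keeps the
  first vector, and normalise the columns. The scalar \<open>k\<close> stays unspecified because an
  eigenvector matters only up to scaling.\<close>

lemma unitary_completion:
  fixes v :: "complex vec"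
  assumes v: "v \<in> carrier_vec n" and v0: "v \<noteq> 0\<^sub>v n"
  obtains U k where "U \<in> carrier_mat n n" "mat_adjoint U * U = 1\<^sub>m n" "col U 0 = k \<cdot>\<^sub>v v"
proof -
  interpret cof_vec_space n "TYPE(complex)" .
  define b where "b = basis_completion v"
  define ws where "ws = gram_schmidt n b"
  from basis_completion[OF v v0, folded b_def]
  have dist_b: "distinct b" and indep: "\<not> lin_dep (set b)" and b: "set b \<subseteq> carrier_vec n"
    and hdb: "hd b = v" and len_b: "length b = n" by auto
  have n: "n \<noteq> 0"
    using v v0 by auto
  with hdb len_b obtain vs where bv: "b = v # vs" by (cases b) auto
  from gram_schmidt_result[OF b dist_b indep refl, folded ws_def]
  have ws: "set ws \<subseteq> carrier_vec n" "corthogonal ws" "length ws = n"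
    by (auto simp: len_b)
  have "hd ws = v"
    using gram_schmidt_hd[OF v, of vs, folded bv] unfolding ws_def .
  then have ws0: "ws ! 0 = v"
    using ws(3) n by (cases ws) auto
  have wsc: "ws ! i \<in> carrier_vec n" if "i < n" for i
    using ws that by auto
  define N where "N i = (\<Sum>a<n. (cmod (ws ! i $ a))\<^sup>2)" for i
  have prod: "ws ! j \<bullet>c ws ! i = (\<Sum>a<n. cnj (ws ! i $ a) * ws ! j $ a)" if "i < n" "j < n" for i j
    using wsc[OF that(1)] wsc[OF that(2)]
    by (auto simp: scalar_prod_def atLeast0LessThan mult.commute)
  have N: "(\<Sum>a<n. cnj (ws ! i $ a) * ws ! i $ a) = of_real (N i)" for i
    unfolding N_def of_real_sum
    by (intro sum.cong refl) (simp add: complex_norm_square mult.commute del: of_real_power)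
  \<comment> \<open>\<open>corthogonal\<close> says that an inner product vanishes exactly when the
    two indices differ, so the vectors are also nonzero.\<close>
  have N0: "N i > 0" if "i < n" for i
  proof -
    have "of_real (N i) \<noteq> (0 :: complex)"
      using corthogonalD[OF ws(2), of i i] prod[OF that that] that ws(3) N[of i] by simp
    moreover have "N i \<ge> 0" unfolding N_def by (intro sum_nonneg) simp
    ultimately show ?thesis by (simp add: less_le)
  qed
  define U where "U = mat n n (\<lambda>(a, i). of_real (1 / sqrt (N i)) * ws ! i $ a)"
  have U: "U \<in> carrier_mat n n" by (simp add: U_def)
  have "mat_adjoint U * U = 1\<^sub>m n"
  proof (intro eq_matI)
    fix i j assume "i < dim_row (1\<^sub>m n :: complex mat)" "j < dim_col (1\<^sub>m n :: complex mat)"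
    then have ij: "i < n" "j < n" by auto
    have "(mat_adjoint U * U) $$ (i, j)
        = of_real (1 / sqrt (N i) * (1 / sqrt (N j))) * (\<Sum>a<n. cnj (ws ! i $ a) * ws ! j $ a)"
      unfolding gram_index[OF U ij] using ij by (simp add: U_def sum_distrib_left mult_ac)
    also have "\<dots> = (if i = j then 1 else 0)"
    proof (cases "i = j")
      case True
      have "1 / sqrt (N i) * (1 / sqrt (N i)) * N i = 1"
        using N0[OF ij(1)] by (simp add: real_sqrt_mult_self field_simps)
      then have "of_real (1 / sqrt (N i) * (1 / sqrt (N i))) * of_real (N i) = (1 :: complex)"
        by (metis of_real_1 of_real_mult)
      then show ?thesis using True N[of i] by simp
    next
      case False
      then show ?thesis
        using corthogonalD[OF ws(2), of j i] prod[OF ij] ij ws(3) by simp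
    qed
    finally show "(mat_adjoint U * U) $$ (i, j) = 1\<^sub>m n $$ (i, j)"
      using ij by simp
  qed (use U in auto)
  moreover have "col U 0 = of_real (1 / sqrt (N 0)) \<cdot>\<^sub>v v"
    using n v ws0 by (intro eq_vecI) (auto simp: U_def)
  ultimately show thesis using that U by blast
qed

section \<open>The spectral theorem\<close>

definition diagonal_of_list :: "complex list \<Rightarrow> complex mat" where
  "diagonal_of_list es = mat (length es) (length es) (\<lambda>(i, j). if i = j then es ! i else 0)"

text \<open>Together with \<open>mult_bordered\<close>, this lets a unitary of size \<open>n\<close>
  be extended by a 1 x 1 block in the inductive step of the spectral theorem.\<close>

lemma mat_adjoint_bordered:
  fixes D :: "complex mat"
  assumes "D \<in> carrier_mat n n"
  shows "mat_adjoint (four_block_mat (mat 1 1 (\<lambda>_. x)) (0\<^sub>m 1 n) (0\<^sub>m n 1) D)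
    = four_block_mat (mat 1 1 (\<lambda>_. cnj x)) (0\<^sub>m 1 n) (0\<^sub>m n 1) (mat_adjoint D)"
  using assms by (intro eq_matI) (auto simp: mat_adjoint_index)

lemma mult_bordered:
  fixes C D :: "complex mat"
  assumes "C \<in> carrier_mat n n" "D \<in> carrier_mat n n"
  shows "four_block_mat (mat 1 1 (\<lambda>_. x)) (0\<^sub>m 1 n) (0\<^sub>m n 1) C
      * four_block_mat (mat 1 1 (\<lambda>_. y)) (0\<^sub>m 1 n) (0\<^sub>m n 1) D
    = four_block_mat (mat 1 1 (\<lambda>_. x * y)) (0\<^sub>m 1 n) (0\<^sub>m n 1) (C * D)"
proof -
  have "mat 1 1 (\<lambda>_. x) * mat 1 1 (\<lambda>_. y) = mat 1 1 (\<lambda>_. x * y)"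
    by (intro eq_matI) (auto simp: scalar_prod_def)
  then show ?thesis
    using assms by (subst mult_four_block_mat[of _ 1 1 _ n _ n _ _ 1 _ n]) auto
qed

text \<open>Deflation: a unitary whose first column is an eigenvector for \<open>e\<close> splits
  off a 1 x 1 block, and the induction hypothesis handles the remaining Hermitian block. Since the
  list \<open>es\<close> is given in advance, the order of the diagonal entries can be prescribed;
  Ky Fan's principle needs the decreasing one.\<close>

theorem hermitian_unitary_diagonalization:
  assumes "A \<in> carrier_mat n n" "hermitian_mat A" "char_poly A = (\<Prod>e\<leftarrow>es. [:- e, 1:])"
  shows "\<exists>U \<in> carrier_mat n n. mat_adjoint U * U = 1\<^sub>m n \<and>
    mat_adjoint U * A * U = diagonal_of_list es"
  using assms
proof (induction es arbitrary: n A)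
  case Nil
  then have "n = 0"
    using degree_monic_char_poly[OF Nil(1)] by auto
  then show ?case
    using Nil by (intro bexI[of _ "1\<^sub>m 0"]) (auto simp: diagonal_of_list_def)
next
  case (Cons e es)
  note A = Cons.prems(1) and herm = Cons.prems(2)
  define k where "k = n - 1"
  have cp: "char_poly A = [:- e, 1:] * (\<Prod>e\<leftarrow>es. [:- e, 1:])"
    using Cons.prems(3) by simp
  have "monic (\<Prod>e\<leftarrow>es. [:- e, 1:])" by (rule monic_prod_list) auto
  then have "degree (char_poly A) = Suc (degree (\<Prod>e\<leftarrow>es. [:- e, 1:]))"
    unfolding cp by (subst degree_mult_eq) auto
  then have n: "n = Suc k"
    using degree_monic_char_poly[OF A] by (simp add: k_def)
  have "eigenvalue A e"
    unfolding eigenvalue_root_char_poly[OF A] cp by simp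
  then obtain v where v: "v \<in> carrier_vec n" "v \<noteq> 0\<^sub>v n" "A *\<^sub>v v = e \<cdot>\<^sub>v v"
    using A unfolding eigenvalue_def eigenvector_def by auto
  obtain V t where V: "V \<in> carrier_mat n n" "mat_adjoint V * V = 1\<^sub>m n" and col: "col V 0 = t \<cdot>\<^sub>v v"
    using unitary_completion[OF v(1,2)] .
  define A' where "A' = mat_adjoint V * A * V"
  have A': "A' \<in> carrier_mat n n" using A V(1) unfolding A'_def by (intro mult_carrier_mat[of _ n n]) auto
  have herm': "hermitian_mat A'"
    unfolding A'_def by (rule hermitian_mat_congruence[OF herm A V(1)])
  \<comment> \<open>Column 0 of \<open>V\<close> is an eigenvector of \<open>A\<close>, so column 0
    of \<open>A'\<close> is \<open>e\<close> times column 0 of \<open>mat_adjoint V * V\<close>, the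
    identity.\<close>
  have A'0: "A' $$ (i, 0) = (if i = 0 then e else 0)" if "i < n" for i
  proof -
    have "A' = mat_adjoint V * (A * V)"
      using A V unfolding A'_def by (intro assoc_mult_mat[of _ n n _ n _ n]) auto
    then have "col A' 0 = mat_adjoint V *\<^sub>v col (A * V) 0"
      using col_mult2[of "mat_adjoint V" n n "A * V" n 0] A V(1) n by auto
    also have "col (A * V) 0 = A *\<^sub>v col V 0"
      using A V(1) n by (intro col_mult2[of _ n n _ n]) auto
    also have "A *\<^sub>v col V 0 = e \<cdot>\<^sub>v col V 0"
      using A v by (simp add: col mult_mat_vec[of _ n n] smult_smult_assoc mult.commute)
    also have "mat_adjoint V *\<^sub>v (e \<cdot>\<^sub>v col V 0) = e \<cdot>\<^sub>v (mat_adjoint V *\<^sub>v col V 0)"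
      using V(1) col v(1) by (intro mult_mat_vec[of _ n n]) auto
    also have "mat_adjoint V *\<^sub>v col V 0 = col (mat_adjoint V * V) 0"
      using V(1) n by (intro col_mult2[symmetric, of _ n n _ n]) auto
    finally have "col A' 0 = e \<cdot>\<^sub>v unit_vec n 0"
      using V(2) n by simp
    from arg_cong[OF this, of "\<lambda>w. w $ i"] show ?thesis
      using that A' n by auto
  qed
  define A3 where "A3 = mat k k (\<lambda>(i, j). A' $$ (Suc i, Suc j))"
  have A3: "A3 \<in> carrier_mat k k" by (simp add: A3_def)
  have block: "A' = four_block_mat (mat 1 1 (\<lambda>_. e)) (0\<^sub>m 1 k) (0\<^sub>m k 1) A3"
  proof (intro eq_matI)
    fix i j
    assume "i < dim_row (four_block_mat (mat 1 1 (\<lambda>_. e)) (0\<^sub>m 1 k) (0\<^sub>m k 1) A3)"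
      "j < dim_col (four_block_mat (mat 1 1 (\<lambda>_. e)) (0\<^sub>m 1 k) (0\<^sub>m k 1) A3)"
    then have ij: "i < n" "j < n" using A3 n by auto
    \<comment> \<open>Hermitian symmetry carries the zeros of column 0 over to row 0, which makes
      \<open>A'\<close> block diagonal and not merely block triangular.\<close>
    have "A' $$ (0, j) = (if j = 0 then e else 0)"
      using hermitian_mat_index[OF herm' A', of 0 j] A'0[OF ij(2)] A'0[of 0] n ij by auto
    then show "A' $$ (i, j) = four_block_mat (mat 1 1 (\<lambda>_. e)) (0\<^sub>m 1 k) (0\<^sub>m k 1) A3 $$ (i, j)"
      using ij n A'0[OF ij(1)] by (cases i; cases j) (auto simp: A3_def)
  qed (use A' A3 n in auto)
  have "hermitian_mat A3"
  proof (rule hermitian_matI[OF A3])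
    fix i j assume "i < k" "j < k"
    then show "A3 $$ (i, j) = cnj (A3 $$ (j, i))"
      using hermitian_mat_index[OF herm' A', of "Suc i" "Suc j"] n by (simp add: A3_def)
  qed
  \<comment> \<open>\<open>A'\<close> is similar to \<open>A\<close>, and its characteristic
    polynomial is that of the 1 x 1 block times that of \<open>A3\<close>; the linear factor of
    \<open>e\<close> cancels.\<close>
  moreover have "char_poly A3 = (\<Prod>e\<leftarrow>es. [:- e, 1:])"
  proof -
    have "similar_mat_wit A' A (mat_adjoint V) V"
      using A A' V unitary_right[OF V] by (intro similar_mat_witI[of _ _ n]) (auto simp: A'_def)
    then have "char_poly A' = char_poly A"
      by (intro char_poly_similar) (auto simp: similar_mat_def)
    moreover have "char_poly A' = char_poly (mat 1 1 (\<lambda>_. e)) * char_poly A3"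
      unfolding block by (rule char_poly_four_block_zeros_col) (use A3 in auto)
    moreover have "char_poly (mat 1 1 (\<lambda>_. e)) = [:- e, 1:]"
      by (simp add: char_poly_defs det_def sign_def)
    ultimately show ?thesis
      using cp by (metis mult_cancel_left pCons_eq_0_iff zero_neq_one)
  qed
  ultimately obtain U' where U': "U' \<in> carrier_mat k k" "mat_adjoint U' * U' = 1\<^sub>m k"
    "mat_adjoint U' * A3 * U' = diagonal_of_list es"
    using Cons.IH[OF A3] by blast
  \<comment> \<open>\<open>F\<close> leaves the eigenvector already found in place and diagonalises
    the remaining block; \<open>V * F\<close> is the unitary sought.\<close>
  define F where "F = four_block_mat (mat 1 1 (\<lambda>_. 1)) (0\<^sub>m 1 k) (0\<^sub>m k 1) U'"
  have F: "F \<in> carrier_mat n n" using U' n by (auto simp: F_def)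
  have "length es = k"
    using arg_cong[OF U'(3), of dim_col] U'(1) by (simp add: diagonal_of_list_def)
  have FF: "mat_adjoint F * F = 1\<^sub>m n"
    unfolding F_def mat_adjoint_bordered[OF U'(1)] using U' n
    by (subst mult_bordered) (auto intro!: eq_matI)
  have "mat_adjoint F * A' * F
      = four_block_mat (mat 1 1 (\<lambda>_. e)) (0\<^sub>m 1 k) (0\<^sub>m k 1) (mat_adjoint U' * A3 * U')"
    unfolding F_def mat_adjoint_bordered[OF U'(1)] block using U'(1) A3
    by (simp only: mult_bordered[of _ k] mat_adjoint_carrier[of _ k k] mult_carrier_mat[of _ k k _ k]) simp
  also have "\<dots> = diagonal_of_list (e # es)"
    unfolding U'(3) using \<open>length es = k\<close>
    by (intro eq_matI) (auto simp: diagonal_of_list_def nth_Cons')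
  finally have diag: "mat_adjoint (V * F) * A * (V * F) = diagonal_of_list (e # es)"
    using congruence_mult[OF V(1) F A] by (simp add: A'_def)
  show ?case
    using diag isometry_mult[OF V F FF] V(1) F by (intro bexI[of _ "V * F"]) auto
qed


text \<open>The roots in any factorisation form the same multiset as \<open>eigvals_down A\<close>,
  and the product ignores their order. This allows the decreasing list as \<open>es\<close> in the
  diagonalisation.\<close>

lemma char_poly_eigvals_down:
  assumes A: "A \<in> carrier_mat n n" and herm: "hermitian_mat A"
  shows "char_poly A = (\<Prod>e\<leftarrow>map complex_of_real (eigvals_down A). [:- e, 1:])"
proof -
  obtain as where as: "char_poly A = (\<Prod>a\<leftarrow>as. [:- a, 1:])"
    using char_poly_factorized[OF A] by blast
  have "proots (\<Prod>a\<leftarrow>as. [:- a, 1:]) = mset as"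
  proof (induction as)
    case (Cons a as)
    have "(\<Prod>a\<leftarrow>as. [:- a, 1:]) \<noteq> 0" by (auto simp: prod_list_zero_iff)
    then show ?case using Cons proots_mult[of "[:- a, 1:]"] by simp
  qed simp
  then have "mset as = mset (map complex_of_real (eigvals_down A))"
    using mset_eigvals_down[OF herm] as by simp
  then have "mset (map (\<lambda>a. [:- a, 1:]) as)
      = mset (map (\<lambda>a. [:- a, 1:]) (map complex_of_real (eigvals_down A)))"
    by (metis mset_map)
  then show ?thesis
    unfolding as by (metis prod_mset_prod_list)
qed

lemma hermitian_spectral_decomposition:
  assumes A: "A \<in> carrier_mat n n" and herm: "hermitian_mat A"
  obtains U where "U \<in> carrier_mat n n" "mat_adjoint U * U = 1\<^sub>m n"
    "mat_adjoint U * A * U = mat n n (\<lambda>(i, j). if i = j then complex_of_real (eigvals_down A ! i) else 0)"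
proof -
  have "diagonal_of_list (map complex_of_real (eigvals_down A))
      = mat n n (\<lambda>(i, j). if i = j then complex_of_real (eigvals_down A ! i) else 0)"
    using length_eigvals_down[OF A] by (intro eq_matI) (auto simp: diagonal_of_list_def)
  then show thesis
    using hermitian_unitary_diagonalization[OF A herm char_poly_eigvals_down[OF A herm]] that by auto
qed

section \<open>Ky Fan's maximum principle\<close>

lemma isometry_row_norm_le_1:
  fixes W :: "complex mat"
  assumes W: "W \<in> carrier_mat n m" and iso: "mat_adjoint W * W = 1\<^sub>m m" and i: "i < n"
  shows "(\<Sum>j<m. (cmod (W $$ (i, j)))\<^sup>2) \<le> 1"
proof -
  \<comment> \<open>\<open>W W\<^sup>*\<close> is an orthogonal projection, so each of its diagonal entries \<open>p\<close> satisfies \<open>p\<^sup>2 \<le> p\<close>.\<close>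
  define P where "P = W * mat_adjoint W"
  have P: "P \<in> carrier_mat n n" using W by (auto simp: P_def)
  have adjP: "mat_adjoint P = P"
    using W by (simp add: P_def mat_adjoint_mult[of _ n m _ n])
  have "P * P = W * (mat_adjoint W * P)"
    unfolding P_def using W by (intro assoc_mult_mat[of _ n m _ n _ n]) auto
  also have "mat_adjoint W * P = mat_adjoint W * W * mat_adjoint W"
    unfolding P_def using W by (intro assoc_mult_mat[symmetric, of _ m n _ m _ n]) auto
  finally have "P * P = P"
    using W iso by (simp add: P_def)
  then have "P $$ (i, i) = (mat_adjoint P * P) $$ (i, i)"
    using adjP by simp
  also have "\<dots> = (\<Sum>a<n. of_real ((cmod (P $$ (a, i)))\<^sup>2))"
    unfolding gram_index[OF P i i]
    by (intro sum.cong refl) (simp add: complex_norm_square mult.commute del: of_real_power)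
  finally have Psum: "P $$ (i, i) = of_real (\<Sum>a<n. (cmod (P $$ (a, i)))\<^sup>2)"
    by simp
  define p where "p = (\<Sum>j<m. (cmod (W $$ (i, j)))\<^sup>2)"
  have Pii: "P $$ (i, i) = of_real p"
  proof -
    have "P $$ (i, i) = (\<Sum>j<m. W $$ (i, j) * cnj (W $$ (i, j)))"
      using W i by (simp add: P_def scalar_prod_def atLeast0LessThan mat_adjoint_index)
    also have "\<dots> = of_real p"
      unfolding p_def of_real_sum
      by (intro sum.cong refl) (simp add: complex_norm_square del: of_real_power)
    finally show ?thesis .
  qed
  have "p\<^sup>2 = (cmod (P $$ (i, i)))\<^sup>2"
    by (simp add: Pii)
  also have "\<dots> \<le> (\<Sum>a<n. (cmod (P $$ (a, i)))\<^sup>2)"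
    using i by (intro member_le_sum) auto
  also have "\<dots> = p"
    using Psum Pii by (metis of_real_eq_iff)
  finally have "p * p \<le> 1 * p" by (simp add: power2_eq_square)
  moreover have "p \<ge> 0" unfolding p_def by (intro sum_nonneg) simp
  ultimately have "p \<le> 1"
    by (cases "p = 0") (auto simp: mult_le_cancel_right)
  then show ?thesis by (simp add: p_def)
qed

text \<open>Compare \<open>w\<close> with the indicator \<open>d\<close> of the first
  \<open>m\<close> indices. Both have total \<open>m\<close>, so subtracting a constant
  \<open>t\<close> from \<open>l\<close> changes both weighted sums equally, and for a suitable
  \<open>t\<close> the comparison holds term by term.\<close>

lemma weighted_sum_le_sum_largest:
  fixes l w :: "nat \<Rightarrow> real"
  assumes mn: "m \<le> n" and anti: "\<And>i j. i \<le> j \<Longrightarrow> j < n \<Longrightarrow> l j \<le> l i"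
    and w: "\<And>i. i < n \<Longrightarrow> 0 \<le> w i" "\<And>i. i < n \<Longrightarrow> w i \<le> 1" "(\<Sum>i<n. w i) = real m"
  shows "(\<Sum>i<n. l i * w i) \<le> (\<Sum>i<m. l i)"
proof (cases "m = 0")
  case True
  then have "\<forall>i\<in>{..<n}. w i = 0"
    using w by (subst sum_nonneg_eq_0_iff[symmetric]) auto
  then show ?thesis using True by simp
next
  case False
  \<comment> \<open>The \<open>m\<close>-th largest value, counting from 0: \<open>l i - t\<close>
    is nonnegative where \<open>d\<close> is 1, hence at least \<open>w\<close>, and nonpositive
    where \<open>d\<close> is 0, hence at most \<open>w\<close>.\<close>
  define t where "t = l (m - 1)"
  define d where "d i = (if i < m then 1 else 0 :: real)" for i
  have split: "(\<Sum>i<n. f i * d i) = (\<Sum>i<m. f i)" for f :: "nat \<Rightarrow> real"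
  proof -
    have "(\<Sum>i<n. f i * d i) = (\<Sum>i\<in>{..<n} \<inter> {i. i < m}. f i)"
      by (simp add: d_def if_distrib sum.If_cases cong: if_cong)
    also have "{..<n} \<inter> {i. i < m} = {..<m}" using mn by auto
    finally show ?thesis .
  qed
  have "(\<Sum>i<n. (l i - t) * w i) \<le> (\<Sum>i<n. (l i - t) * d i)"
  proof (intro sum_mono)
    fix i assume "i \<in> {..<n}"
    then have i: "i < n" by simp
    show "(l i - t) * w i \<le> (l i - t) * d i"
    proof (cases "i < m")
      case True
      then have "t \<le> l i" unfolding t_def using mn False by (intro anti) auto
      then show ?thesis using True w(2)[OF i] by (intro mult_left_mono) (auto simp: d_def)
    next
      case F: False
      then have "l i \<le> t" unfolding t_def using i False by (intro anti) auto
      then show ?thesis using F w(1)[OF i] by (auto simp: d_def mult_nonpos_nonneg)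
    qed
  qed
  moreover have "(\<Sum>i<n. (l i - t) * w i) = (\<Sum>i<n. l i * w i) - t * real m"
    by (simp add: left_diff_distrib sum_subtractf w(3) flip: sum_distrib_left)
  moreover have "(\<Sum>i<n. (l i - t) * d i) = (\<Sum>i<m. l i) - t * real m"
    unfolding split by (simp add: sum_subtractf)
  ultimately show ?thesis by linarith
qed

text \<open>In an eigenbasis \<open>V\<close> becomes the isometry \<open>W\<close>, and the trace
  becomes the sum of the eigenvalues weighted by the squared row norms of \<open>W\<close>. These
  weights lie between 0 and 1, and they add up to \<open>m\<close> because the \<open>m\<close>
  columns are unit vectors.\<close>

lemma ky_fan_upper:
  assumes X: "X \<in> carrier_mat n n" and herm: "hermitian_mat X"
    and V: "V \<in> carrier_mat n m" and iso: "mat_adjoint V * V = 1\<^sub>m m" and mn: "m \<le> n"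
  shows "(\<Sum>j<m. Re ((mat_adjoint V * X * V) $$ (j, j))) \<le> (\<Sum>i<m. eigvals_down X ! i)"
proof -
  let ?l = "\<lambda>i. eigvals_down X ! i"
  define D where "D = mat n n (\<lambda>(i, j). if i = j then complex_of_real (?l i) else 0)"
  obtain U where U: "U \<in> carrier_mat n n" "mat_adjoint U * U = 1\<^sub>m n"
    and diag: "mat_adjoint U * X * U = D"
    using hermitian_spectral_decomposition[OF X herm] unfolding D_def by blast
  have UU: "U * mat_adjoint U = 1\<^sub>m n" by (rule unitary_right[OF U])
  define W where "W = mat_adjoint U * V"
  have W: "W \<in> carrier_mat n m" using U V by (auto simp: W_def)
  have "U * W = U * mat_adjoint U * V"
    unfolding W_def using U V by (intro assoc_mult_mat[symmetric, of _ n n _ n _ m]) auto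
  then have UW: "U * W = V" using UU V by simp
  have isoW: "mat_adjoint W * W = 1\<^sub>m m"
    unfolding W_def using U V UU iso by (intro isometry_mult[of _ n n]) auto
  have VXV: "mat_adjoint V * X * V = mat_adjoint W * D * W"
    using congruence_mult[OF U(1) W X] unfolding UW diag .
  define w where "w i = (\<Sum>j<m. (cmod (W $$ (i, j)))\<^sup>2)" for i
  have entry: "Re ((mat_adjoint V * X * V) $$ (j, j)) = (\<Sum>i<n. ?l i * (cmod (W $$ (i, j)))\<^sup>2)"
    if "j < m" for j
  proof -
    have "(mat_adjoint W * D * W) $$ (j, j)
        = (\<Sum>a<n. \<Sum>b<n. cnj (W $$ (a, j)) * D $$ (a, b) * W $$ (b, j))"
      by (rule congruence_index[OF W _ that that]) (simp add: D_def)
    also have "\<dots> = (\<Sum>a<n. \<Sum>b<n. if b = a then of_real (?l a) * (W $$ (a, j) * cnj (W $$ (a, j))) else 0)"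
      by (intro sum.cong refl) (auto simp: D_def)
    also have "\<dots> = (\<Sum>a<n. of_real (?l a * (cmod (W $$ (a, j)))\<^sup>2))"
      by (intro sum.cong refl) (simp add: sum.delta complex_norm_square del: of_real_power)
    finally show ?thesis
      unfolding VXV by simp
  qed
  have colsum: "(\<Sum>i<n. (cmod (W $$ (i, j)))\<^sup>2) = 1" if "j < m" for j
  proof -
    have "(1 :: complex) = (mat_adjoint W * W) $$ (j, j)"
      using isoW that by simp
    also have "\<dots> = (\<Sum>i<n. of_real ((cmod (W $$ (i, j)))\<^sup>2))"
      unfolding gram_index[OF W that that]
      by (intro sum.cong refl) (simp add: complex_norm_square mult.commute del: of_real_power)
    finally have "complex_of_real 1 = of_real (\<Sum>i<n. (cmod (W $$ (i, j)))\<^sup>2)"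
      by simp
    then show ?thesis by (simp only: of_real_eq_iff)
  qed
  have "(\<Sum>j<m. Re ((mat_adjoint V * X * V) $$ (j, j))) = (\<Sum>i<n. ?l i * w i)"
    unfolding w_def sum_distrib_left by (subst sum.swap) (simp add: entry)
  also have "\<dots> \<le> (\<Sum>i<m. ?l i)"
  proof (rule weighted_sum_le_sum_largest[OF mn])
    show "?l j \<le> ?l i" if "i \<le> j" "j < n" for i j
      using sorted_wrt_nth_less[OF sorted_eigvals_down, of i j X] that length_eigvals_down[OF X]
      by (cases "i = j") auto
    show "(\<Sum>i<n. w i) = real m"
      unfolding w_def by (subst sum.swap) (simp add: colsum)
  qed (auto simp: w_def intro: sum_nonneg isometry_row_norm_le_1[OF W isoW])
  finally show ?thesis .
qed

text \<open>The first \<open>m\<close> columns of the diagonalising unitary are orthonormal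
  eigenvectors for the \<open>m\<close> largest eigenvalues.\<close>

lemma ky_fan_attained:
  assumes X: "X \<in> carrier_mat n n" and herm: "hermitian_mat X" and mn: "m \<le> n"
  obtains V where "V \<in> carrier_mat n m" "mat_adjoint V * V = 1\<^sub>m m"
    "(\<Sum>j<m. Re ((mat_adjoint V * X * V) $$ (j, j))) = (\<Sum>i<m. eigvals_down X ! i)"
proof -
  obtain U where U: "U \<in> carrier_mat n n" "mat_adjoint U * U = 1\<^sub>m n"
    and diag: "mat_adjoint U * X * U
      = mat n n (\<lambda>(i, j). if i = j then complex_of_real (eigvals_down X ! i) else 0)"
    using hermitian_spectral_decomposition[OF X herm] .
  define V where "V = mat n m (\<lambda>(i, j). U $$ (i, j))"
  have V: "V \<in> carrier_mat n m" by (simp add: V_def)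
  have "(mat_adjoint V * V) $$ (i, j) = (mat_adjoint U * U) $$ (i, j)" if "i < m" "j < m" for i j
    unfolding gram_index[OF V that] using that mn
    by (subst gram_index[OF U(1)]) (auto simp: V_def)
  then have "mat_adjoint V * V = 1\<^sub>m m"
    unfolding U(2) using V mn by (intro eq_matI) auto
  moreover have "(mat_adjoint V * X * V) $$ (j, j) = of_real (eigvals_down X ! j)" if "j < m" for j
  proof -
    have "(mat_adjoint V * X * V) $$ (j, j) = (mat_adjoint U * X * U) $$ (j, j)"
      unfolding congruence_index[OF V X that that] using that mn
      by (subst congruence_index[OF U(1) X]) (auto simp: V_def)
    then show ?thesis using diag that mn by simp
  qed
  then have "(\<Sum>j<m. Re ((mat_adjoint V * X * V) $$ (j, j))) = (\<Sum>i<m. eigvals_down X ! i)"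
    by simp
  ultimately show thesis using that V by blast
qed

text \<open>An isometry that is optimal for \<open>Z\<close> is a competitor for every
  \<open>X k\<close>, and the compressed trace is linear. The general index set serves both the
  average over phases and the two-term splitting of \<open>B + A\<close>.\<close>

lemma sum_eigvals_down_sublinear:
  assumes Z: "Z \<in> carrier_mat n n" "hermitian_mat Z" and mn: "m \<le> n"
    and X: "\<And>k. k \<in> K \<Longrightarrow> X k \<in> carrier_mat n n" "\<And>k. k \<in> K \<Longrightarrow> hermitian_mat (X k)"
    and t: "\<And>k. k \<in> K \<Longrightarrow> t k \<ge> 0"
    and comb: "\<And>a b. a < n \<Longrightarrow> b < n \<Longrightarrow> Z $$ (a, b) = (\<Sum>k\<in>K. complex_of_real (t k) * X k $$ (a, b))"
  shows "(\<Sum>i<m. eigvals_down Z ! i) \<le> (\<Sum>k\<in>K. t k * (\<Sum>i<m. eigvals_down (X k) ! i))"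
proof -
  obtain V where V: "V \<in> carrier_mat n m" "mat_adjoint V * V = 1\<^sub>m m"
    and eq: "(\<Sum>j<m. Re ((mat_adjoint V * Z * V) $$ (j, j))) = (\<Sum>i<m. eigvals_down Z ! i)"
    using ky_fan_attained[OF Z mn] .
  have entry: "(mat_adjoint V * Z * V) $$ (j, j)
      = (\<Sum>k\<in>K. of_real (t k) * (mat_adjoint V * X k * V) $$ (j, j))" if j: "j < m" for j
  proof -
    have "(mat_adjoint V * Z * V) $$ (j, j)
        = (\<Sum>a<n. \<Sum>b<n. \<Sum>k\<in>K. of_real (t k) * (cnj (V $$ (a, j)) * X k $$ (a, b) * V $$ (b, j)))"
      unfolding congruence_index[OF V(1) Z(1) j j]
      by (intro sum.cong refl) (simp add: comb sum_distrib_left sum_distrib_right mult_ac)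
    also have "\<dots> = (\<Sum>a<n. \<Sum>k\<in>K. \<Sum>b<n. of_real (t k) * (cnj (V $$ (a, j)) * X k $$ (a, b) * V $$ (b, j)))"
      by (intro sum.cong refl sum.swap)
    also have "\<dots> = (\<Sum>k\<in>K. \<Sum>a<n. \<Sum>b<n. of_real (t k) * (cnj (V $$ (a, j)) * X k $$ (a, b) * V $$ (b, j)))"
      by (rule sum.swap)
    also have "\<dots> = (\<Sum>k\<in>K. of_real (t k) * (mat_adjoint V * X k * V) $$ (j, j))"
      by (intro sum.cong refl) (simp add: congruence_index[OF V(1) X(1) j j] sum_distrib_left)
    finally show ?thesis .
  qed
  have "(\<Sum>i<m. eigvals_down Z ! i)
      = (\<Sum>j<m. \<Sum>k\<in>K. t k * Re ((mat_adjoint V * X k * V) $$ (j, j)))"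
    unfolding eq[symmetric] by (intro sum.cong refl) (simp add: entry)
  also have "\<dots> = (\<Sum>k\<in>K. t k * (\<Sum>j<m. Re ((mat_adjoint V * X k * V) $$ (j, j))))"
    unfolding sum_distrib_left by (rule sum.swap)
  also have "\<dots> \<le> (\<Sum>k\<in>K. t k * (\<Sum>i<m. eigvals_down (X k) ! i))"
    by (intro sum_mono mult_left_mono ky_fan_upper[OF X V mn] t)
  finally show ?thesis .
qed

lemma sum_lambda_down: "(\<Sum>i=1..m. lambda_down X i) = (\<Sum>i<m. eigvals_down X ! i)"
  unfolding lambda_down_def
  by (rule sum.reindex_bij_witness[of _ Suc "\<lambda>i. i - 1"]) auto

section \<open>Averaging over the colour phases\<close>

text \<open>\<open>eigvals_down\<close> depends only on the characteristic polynomial, which similar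
  matrices share.\<close>

lemma eigvals_down_unitary_conjugation:
  assumes X: "X \<in> carrier_mat n n" and U: "U \<in> carrier_mat n n" "mat_adjoint U * U = 1\<^sub>m n"
  shows "eigvals_down (mat_adjoint U * X * U) = eigvals_down X"
proof -
  have "similar_mat_wit (mat_adjoint U * X * U) X (mat_adjoint U) U"
    using X U unitary_right[OF U] by (intro similar_mat_witI[of _ _ n]) auto
  then have "char_poly (mat_adjoint U * X * U) = char_poly X"
    by (intro char_poly_similar) (auto simp: similar_mat_def)
  then show ?thesis by (simp add: eigvals_down_def)
qed

lemma diagonal_phase_conjugation:
  fixes X :: "complex mat" and z :: "nat \<Rightarrow> complex"
  assumes X: "X \<in> carrier_mat n n" and z: "\<And>a. cmod (z a) = 1"
  defines "Y \<equiv> mat n n (\<lambda>(a, b). z a * cnj (z b) * X $$ (a, b))"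
  shows "eigvals_down Y = eigvals_down X"
proof -
  \<comment> \<open>The entries are conjugated because the left factor in the congruence is the
    adjoint of \<open>U\<close>, which then carries \<open>z a\<close> itself.\<close>
  define U where "U = mat n n (\<lambda>(a, b). if a = b then cnj (z a) else 0)"
  have U: "U \<in> carrier_mat n n" by (simp add: U_def)
  have zz: "z a * cnj (z a) = 1" for a
    using complex_norm_square[of "z a"] z[of a] by simp
  have iso: "mat_adjoint U * U = 1\<^sub>m n"
  proof (intro eq_matI)
    fix i j assume "i < dim_row (1\<^sub>m n :: complex mat)" "j < dim_col (1\<^sub>m n :: complex mat)"
    then have ij: "i < n" "j < n" by auto
    have "(mat_adjoint U * U) $$ (i, j) = (\<Sum>a<n. if a = i then (if i = j then 1 else 0) else 0)"
      unfolding gram_index[OF U ij] using ij by (intro sum.cong refl) (auto simp: U_def zz)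
    then show "(mat_adjoint U * U) $$ (i, j) = 1\<^sub>m n $$ (i, j)"
      using ij by (simp add: sum.delta)
  qed (use U in auto)
  have "mat_adjoint U * X * U = Y"
  proof (intro eq_matI)
    fix i j assume "i < dim_row Y" "j < dim_col Y"
    then have ij: "i < n" "j < n" by (auto simp: Y_def)
    have "(mat_adjoint U * X * U) $$ (i, j)
        = (\<Sum>a<n. if a = i then \<Sum>b<n. if b = j then Y $$ (i, j) else 0 else 0)"
      unfolding congruence_index[OF U X ij] using ij
      by (intro sum.cong refl) (auto simp: U_def Y_def mult_ac if_distrib sum.delta cong: if_cong)
    then show "(mat_adjoint U * X * U) $$ (i, j) = Y $$ (i, j)"
      using ij by (simp add: sum.delta)
  qed (use U in \<open>auto simp: Y_def\<close>)
  then show ?thesis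
    using eigvals_down_unitary_conjugation[OF X U iso] by simp
qed

text \<open>The full geometric sum vanishes, and the omitted term for exponent 0 is 1.\<close>

lemma sum_powers_root_of_unity:
  fixes z :: complex
  assumes "z ^ c = 1" "z \<noteq> 1" "c > 0"
  shows "(\<Sum>k=1..<c. z ^ k) = -1"
proof -
  have "(\<Sum>k<c. z ^ k) = 0"
    using assms by (simp add: geometric_sum)
  moreover have "{..<c} = insert 0 {1..<c}" using assms(3) by auto
  ultimately show ?thesis by (simp add: add_eq_0_iff)
qed

text \<open>Encodes a colouring by giving each colour its own \<open>c\<close>-th root of unity, so
  that equal phases mean equal colours.\<close>

lemma colorable_mat_phases:
  assumes A: "A \<in> carrier_mat n n" and col: "colorable_mat A c" and c: "c > 0"
  obtains z :: "nat \<Rightarrow> complex" where "\<And>a. cmod (z a) = 1" "\<And>a. z a ^ c = 1"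
    "\<And>a b. a < n \<Longrightarrow> b < n \<Longrightarrow> z a = z b \<Longrightarrow> A $$ (a, b) = 0"
proof -
  obtain V :: "nat \<Rightarrow> nat set" where V: "(\<Union>s\<in>{1..c}. V s) = {0..<n}"
    and zero: "\<And>s k l. s \<in> {1..c} \<Longrightarrow> k \<in> V s \<Longrightarrow> l \<in> V s \<Longrightarrow> A $$ (k, l) = 0"
    using col A unfolding colorable_mat_def by auto
  have "\<forall>a. \<exists>s. a < n \<longrightarrow> s \<in> {1..c} \<and> a \<in> V s"
    using V by (metis UN_E atLeastLessThan_iff le0)
  then obtain f where f: "\<And>a. a < n \<Longrightarrow> f a \<in> {1..c} \<and> a \<in> V (f a)"
    by metis
  \<comment> \<open>Colours start at 1, so \<open>f a - 1\<close> lies in \<open>{..<c}\<close>,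
    where these roots are pairwise distinct. Outside the vertex set \<open>f a\<close> is arbitrary,
    yet \<open>z a\<close> is still a \<open>c\<close>-th root of unity.\<close>
  define z where "z a = cis (2 * pi * real (f a - 1) / real c)" for a
  have "z a ^ c = 1" for a
    using c by (simp add: z_def DeMoivre cis_multiple_2pi)
  moreover have "A $$ (a, b) = 0" if ab: "a < n" "b < n" and eq: "z a = z b" for a b
  proof -
    have "inj_on (\<lambda>k. cis (2 * pi * real k / real c)) {..<c}"
      using bij_betw_roots_unity[OF c] by (auto simp: bij_betw_def)
    moreover have "f a - 1 \<in> {..<c}" "f b - 1 \<in> {..<c}"
      using f[OF ab(1)] f[OF ab(2)] by auto
    ultimately have "f a - 1 = f b - 1"
      using eq unfolding z_def by (auto dest: inj_onD)
    then have "f a = f b"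
      using f[OF ab(1)] f[OF ab(2)] by auto
    then show ?thesis
      using zero[of "f a" a b] f[OF ab(1)] f[OF ab(2)] by auto
  qed
  ultimately show thesis
    using that[of z] by (simp add: z_def)
qed

section \<open>The two inequalities\<close>

theorem theorem3:
  fixes A B :: "complex mat" and n c m :: nat
  assumes "A \<in> carrier_mat n n" and "hermitian_mat A"
    and "c \<ge> 2" and "colorable_mat A c"
    and "B \<in> carrier_mat n n" and "real_diagonal_mat B"
    and "m \<in> {1..n}"
  shows "(\<Sum>i=1..m. lambda_down (B - A) i)
           \<ge> (\<Sum>i=1..m. lambda_down (B + complex_of_real (1 / (real c - 1)) \<cdot>\<^sub>m A) i) \<and>
         (\<Sum>i=1..m. lambda_down (B + complex_of_real (1 / (real c - 1)) \<cdot>\<^sub>m A) i)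
           \<ge> (\<Sum>i=1..m. lambda_down (B + A) i)
               - (real c - 2) / (real c - 1) * (\<Sum>i=1..m. lambda_down A i)"
proof -
  note A = assms(1) and B = assms(5)
  have mn: "m \<le> n" using assms(7) by simp
  define r where "r = 1 / (real c - 1)"
  have r: "r \<ge> 0" "r * (real c - 1) = 1" using assms(3) by (auto simp: r_def)
  define Z where "Z = B + complex_of_real r \<cdot>\<^sub>m A"
  have hA: "A $$ (i, j) = cnj (A $$ (j, i))" if "i < n" "j < n" for i j
    by (rule hermitian_mat_index[OF assms(2) A that])
  have B0: "B $$ (i, j) = 0" if "i < n" "j < n" "i \<noteq> j" for i j
    using assms(6) B that by (auto simp: real_diagonal_mat_def diagonal_mat_def)
  have hB: "B $$ (i, j) = cnj (B $$ (j, i))" if "i < n" "j < n" for i j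
    using assms(6) B that B0
    by (cases "i = j") (auto simp: real_diagonal_mat_def Reals_cnj_iff)
  \<comment> \<open>Covers both \<open>Z\<close>, with \<open>s\<close> equal to \<open>r\<close>,
    and \<open>B + A\<close>, with \<open>s\<close> equal to 1.\<close>
  have comb_herm: "hermitian_mat X"
    if "X \<in> carrier_mat n n" "\<And>i j. i < n \<Longrightarrow> j < n \<Longrightarrow> X $$ (i, j) = B $$ (i, j) + of_real s * A $$ (i, j)"
    for X s
  proof (rule hermitian_matI[OF that(1)])
    fix i j assume ij: "i < n" "j < n"
    show "X $$ (i, j) = cnj (X $$ (j, i))"
      using that(2)[OF ij] that(2)[OF ij(2,1)] hA[OF ij] hB[OF ij] by simp
  qed
  have Z: "Z \<in> carrier_mat n n" using A B by (simp add: Z_def)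
  have Z_index: "Z $$ (i, j) = B $$ (i, j) + of_real r * A $$ (i, j)" if "i < n" "j < n" for i j
    using A B that by (simp add: Z_def)
  have hZ: "hermitian_mat Z" by (rule comb_herm[OF Z Z_index])

  obtain z :: "nat \<Rightarrow> complex" where z: "\<And>a. cmod (z a) = 1" "\<And>a. z a ^ c = 1"
    and zA: "\<And>a b. a < n \<Longrightarrow> b < n \<Longrightarrow> z a = z b \<Longrightarrow> A $$ (a, b) = 0"
    using colorable_mat_phases[OF A assms(4)] assms(3) by auto
  have zz: "z a * cnj (z a) = 1" for a
    using complex_norm_square[of "z a"] z(1)[of a] by simp
  \<comment> \<open>The conjugate of \<open>B - A\<close> by the \<open>k\<close>-th power of the
    phase matrix, written entrywise; \<open>Z\<close> will be the average over \<open>k\<close> from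
    1 to \<open>c - 1\<close>, with weight \<open>r\<close> each.\<close>
  define Y where "Y k = mat n n (\<lambda>(a, b). z a ^ k * cnj (z b ^ k) * (B - A) $$ (a, b))" for k
  have BA: "B - A \<in> carrier_mat n n" using A by (rule minus_carrier_mat)
  have "(\<Sum>i<m. eigvals_down Z ! i) \<le> (\<Sum>k\<in>{1..<c}. r * (\<Sum>i<m. eigvals_down (Y k) ! i))"
  proof (rule sum_eigvals_down_sublinear[OF Z hZ mn])
    show "hermitian_mat (Y k)" for k
    proof (rule hermitian_matI)
      fix i j assume ij: "i < n" "j < n"
      then show "Y k $$ (i, j) = cnj (Y k $$ (j, i))"
        using A B hA[OF ij] hB[OF ij] by (simp add: Y_def)
    qed (simp add: Y_def)
    fix a b assume ab: "a < n" "b < n"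
    \<comment> \<open>The entry at \<open>(a, b)\<close> of \<open>Y k\<close> is that of
      \<open>B - A\<close> times \<open>w ^ k\<close>, so averaging reduces to a power sum of one
      root of unity.\<close>
    define w where "w = z a * cnj (z b)"
    have w: "w ^ c = 1"
      using z(2) by (simp add: w_def power_mult_distrib flip: complex_cnj_power)
    have "(\<Sum>k\<in>{1..<c}. complex_of_real r * Y k $$ (a, b))
        = of_real r * (\<Sum>k\<in>{1..<c}. w ^ k) * (B - A) $$ (a, b)"
      using ab by (simp add: Y_def w_def power_mult_distrib sum_distrib_left sum_distrib_right mult_ac)
    also have "\<dots> = Z $$ (a, b)"
    \<comment> \<open>With equal phases, as on the diagonal, the factor is 1 and the entry of
      \<open>A\<close> is 0, which leaves the entry of \<open>B\<close>. With different phases the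
      factor is \<open>-r\<close> and the entry of \<open>B\<close> is 0, which leaves
      \<open>r\<close> times the entry of \<open>A\<close>.\<close>
    proof (cases "z a = z b")
      case True
      then have "(\<Sum>k\<in>{1..<c}. w ^ k) = of_real (real c - 1)"
        using zz assms(3) by (simp add: w_def of_nat_diff)
      then have "of_real r * (\<Sum>k\<in>{1..<c}. w ^ k) = 1"
        using r(2) by (metis of_real_1 of_real_mult)
      then show ?thesis
        using zA[OF ab True] ab A B by (simp add: Z_index)
    next
      case False
      have "w \<noteq> 1"
      proof
        \<comment> \<open>Multiplying by \<open>z b\<close>, which has modulus 1, gives
          \<open>z a = z b\<close>.\<close>
        assume "w = 1"
        then have "z b = z a * (z b * cnj (z b))"
          by (simp add: w_def mult.assoc[symmetric] mult.commute mult.left_commute)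
        then show False using False zz by simp
      qed
      then have "(\<Sum>k\<in>{1..<c}. w ^ k) = -1"
        using sum_powers_root_of_unity[OF w] assms(3) by simp
      moreover have "B $$ (a, b) = 0"
        using False by (intro B0 ab) auto
      ultimately show ?thesis
        using ab A B by (simp add: Z_index)
    qed
    finally show "Z $$ (a, b) = (\<Sum>k\<in>{1..<c}. complex_of_real r * Y k $$ (a, b))" by simp
  qed (use r in \<open>auto simp: Y_def\<close>)
  also have "\<dots> = (\<Sum>k\<in>{1..<c}. r * (\<Sum>i<m. eigvals_down (B - A) ! i))"
  proof -
    have "eigvals_down (Y k) = eigvals_down (B - A)" for k
      unfolding Y_def by (rule diagonal_phase_conjugation[OF BA]) (simp add: z norm_power)
    then show ?thesis by simp
  qed
  also have "\<dots> = (r * (real c - 1)) * (\<Sum>i<m. eigvals_down (B - A) ! i)"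
    using assms(3) by (simp add: of_nat_diff)
  finally have first: "(\<Sum>i<m. eigvals_down Z ! i) \<le> (\<Sum>i<m. eigvals_down (B - A) ! i)"
    unfolding r(2) by simp

  \<comment> \<open>The share of \<open>A\<close> missing from \<open>Z\<close>, so that
    \<open>B + A\<close> is \<open>Z\<close> plus \<open>s\<close> times \<open>A\<close>;
    \<open>s\<close> is nonnegative because \<open>c\<close> is at least 2.\<close>
  define s where "s = (real c - 2) / (real c - 1)"
  have s: "s \<ge> 0" "r + s = 1"
    using assms(3) by (auto simp: s_def r_def simp flip: add_divide_distrib)
  \<comment> \<open>Sublinearity over a two-element index set: \<open>True\<close> stands for
    \<open>Z\<close> with weight 1, \<open>False\<close> for \<open>A\<close> with weight
    \<open>s\<close>.\<close>
  have "(\<Sum>i<m. eigvals_down (B + A) ! i)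
      \<le> (\<Sum>k\<in>{True, False}. (if k then 1 else s) * (\<Sum>i<m. eigvals_down (if k then Z else A) ! i))"
  proof (rule sum_eigvals_down_sublinear[OF _ _ mn])
    show BpA: "B + A \<in> carrier_mat n n" using A by (rule add_carrier_mat)
    show "hermitian_mat (B + A)"
      by (rule comb_herm[OF BpA, of 1]) (use A B in auto)
    fix a b assume ab: "a < n" "b < n"
    have "of_real r * A $$ (a, b) + of_real s * A $$ (a, b) = A $$ (a, b)"
      using s(2) by (metis distrib_right mult_1 of_real_1 of_real_add)
    then show "(B + A) $$ (a, b)
        = (\<Sum>k\<in>{True, False}. complex_of_real (if k then 1 else s) * (if k then Z else A) $$ (a, b))"
      using ab A B by (simp add: Z_index add.assoc)
  qed (use A Z hZ assms(2) s in auto)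
  then have second: "(\<Sum>i<m. eigvals_down Z ! i)
      \<ge> (\<Sum>i<m. eigvals_down (B + A) ! i) - s * (\<Sum>i<m. eigvals_down A ! i)"
    by simp
  show ?thesis
    using first second unfolding sum_lambda_down Z_def r_def s_def by simp
qed

end
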